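(* The LTL model-checking problem for hybrid Kripke structures is undecidable. Here the LTL model-checking problem is: given a hybrid Kripke structure $(\mathcal{H},P,L)$ and an LTL formula $\phi$ over $P$, decide whether $(\mathcal{H},P,L)\models\phi$, i.e. whether all traces of $(\mathcal{H},P,L)$ satisfy $\phi$ (and, if not, give a counterexample, i.e. a run violating $\phi$).
   Context: **Undecidability.** A problem is decidable if one can write a computer program that always terminates with a correct answer; it is undecidable if no such program exists. **Predicates.** For a finite set $X$ of real-valued variables, a valuation is a point $\nu\in\mathbb{R}^{|X|}$, and a predicate over $X$ is a subset of $\mathbb{R}^{|X|}$ (for computer-readable representation, predicates are often defined using non-linear algebraic equations involving $X$). The set of predicates over $X$ is $\mathrm{pred}(X)$, and $[\![\pi]\!]$ denotes the set of valuations satisfying $\pi$. $X'$ denotes a set of primed copies of the variables in $X$; a predicate over $X\cup X'$ is a set of pairs $(\nu,\nu')$. **Hybrid automaton.** A hybrid automaton is a tuple $\mathcal{H}=(M,M_0,\Sigma,X,\Delta,I,F,V_0)$ where - $M$ is a finite set of modes and $M_0\subseteq M$ is the set of initial modes; - $\Sigma$ is a finite set of actions; - $X$ is a finite set of real-valued variables; - $\Delta\subseteq M\times\mathrm{pred}(X)\times\Sigma\times\mathrm{pred}(X\cup X')\times M$ is the transition relation, whose elements are written $(m,g,a,j,m')$ with guard $g$ and jump predicate $j$; - $I:M\to\mathrm{pred}(X)$ gives the mode invariants; - $F:M\to(\mathbb{R}^{|X|}\to\mathbb{R}^{|X|})$ gives for each mode $m$ a Lipschitz-continuous flow function $F(m)$,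 defining the system of ODEs $\dot X=F(m)(X)$; - $V_0\in\mathrm{pred}(X)$ is the set of initial valuations. For $t\in\mathbb{R}_{\ge0}$, $\nu\oplus_{F(m)}t$ denotes the value at time $t$ of the unique solution of $\dot X=F(m)(X)$ with initial value $\nu$. **Semantics.** The configurations of $\mathcal{H}$ are the pairs $(m,\nu)\in M\times\mathbb{R}^{|X|}$ with $\nu\in[\![I(m)]\!]$. A configuration is initial if $m\in M_0$ and $\nu\in V_0$. There is a transition from $(m,\nu)$ to $(m',\nu')$ labelled $(t,a)\in\mathbb{R}_{\ge0}\times\Sigma$ if there is $(m,g,a,j,m')\in\Delta$ such that $\nu\oplus_{F(m)}t\in[\![g]\!]$; $\nu\oplus_{F(m)}\tau\in[\![I(m)]\!]$ for all $\tau\in[0,t]$; $(\nu\oplus_{F(m)}t,\nu')\in[\![j]\!]$; and $\nu'\in[\![I(m')]\!]$. An infinite run is an infinite sequence $\langle(m_0,\nu_0),(t_1,a_1),(m_1,\nu_1),(t_2,a_2),\ldots\rangle$ starting in an initial configuration and such that consecutive configurations are connected by transitions with the indicated labels. **Hybrid Kripke structure.** A hybrid Kripke structure is a tuple $(\mathcal{H},P,L)$ with $\mathcal{H}$ a hybrid automaton, $P$ a finite set of atomic propositions, and $L:M\to2^P$ a labeling function. The trace of an infinite run is $\langle L(m_0),L(m_1),L(m_2),\ldots\rangle$. $\mathrm{Trace}(\mathcal{H},P,L)$ is the set of traces of $(\mathcal{H},P,L)$. **LTL.** Formulas over $P$ are generated from $\top$, $\bot$ and $p\in P$ by $\neg\phi$,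 $\phi\wedge\psi$, $\phi\vee\psi$, $\bigcirc\phi$, $\Diamond\phi$, $\Box\phi$, $\phi\,\mathcal{U}\,\psi$. For a trace $\sigma=\langle P_0,P_1,\ldots\rangle$ with suffixes $\sigma[i]=\langle P_i,P_{i+1},\ldots\rangle$: $\sigma\models\top$; $\sigma\not\models\bot$; $\sigma\models p$ iff $p\in P_0$; Boolean connectives are as usual; $\sigma\models\bigcirc\phi$ iff $\sigma[1]\models\phi$; $\sigma\models\Diamond\phi$ iff $\sigma[i]\models\phi$ for some $i\ge0$; $\sigma\models\Box\phi$ iff $\sigma[i]\models\phi$ for all $i\ge0$; $\sigma\models\phi\,\mathcal{U}\,\psi$ iff there is $i\ge0$ with $\sigma[i]\models\psi$ and $\sigma[j]\models\phi$ for all $0\le j<i$. Finally $(\mathcal{H},P,L)\models\phi$ iff $\sigma\models\phi$ for every $\sigma\in\mathrm{Trace}(\mathcal{H},P,L)$. *)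

theory Defs
  imports "HOL-Analysis.Analysis" "HOL-Library.Nat_Bijection"
begin

section \<open>Hybrid automata\<close>

text \<open>Valuations of \<open>X\<close> are functions that are \<open>undefined\<close> outside \<open>X\<close>, so that they correspond
  exactly to the points of the space of dimension \<open>card X\<close>.\<close>

definition valuations :: "'x set \<Rightarrow> ('x \<Rightarrow> real) set" where
  "valuations X = (X \<rightarrow>\<^sub>E UNIV)"

record ('m, 'a, 'x) hybrid_automaton =
  modes :: "'m set"
  initial_modes :: "'m set"
  actions :: "'a set"
  variables :: "'x set"
  transitions :: "('m \<times> ('x \<Rightarrow> real) set \<times> 'a \<times> (('x \<Rightarrow> real) \<times> ('x \<Rightarrow> real)) set \<times> 'm) set"
  invariant :: "'m \<Rightarrow> ('x \<Rightarrow> real) set"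
  flow :: "'m \<Rightarrow> ('x \<Rightarrow> real) \<Rightarrow> ('x \<Rightarrow> real)"
  initial_valuations :: "('x \<Rightarrow> real) set"

definition euclidean_dist :: "'x set \<Rightarrow> ('x \<Rightarrow> real) \<Rightarrow> ('x \<Rightarrow> real) \<Rightarrow> real" where
  "euclidean_dist X \<nu> \<mu> = L2_set (\<lambda>x. \<nu> x - \<mu> x) X"

definition lipschitz_field :: "'x set \<Rightarrow> (('x \<Rightarrow> real) \<Rightarrow> ('x \<Rightarrow> real)) \<Rightarrow> bool" where
  "lipschitz_field X f \<longleftrightarrow>
     (\<exists>K. \<forall>\<nu>\<in>valuations X. \<forall>\<mu>\<in>valuations X.
        euclidean_dist X (f \<nu>) (f \<mu>) \<le> K * euclidean_dist X \<nu> \<mu>)"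

definition wf_hybrid_automaton :: "('m, 'a, 'x) hybrid_automaton \<Rightarrow> bool" where
  "wf_hybrid_automaton H \<longleftrightarrow>
     finite (modes H) \<and> initial_modes H \<subseteq> modes H \<and>
     finite (actions H) \<and> finite (variables H) \<and>
     transitions H \<subseteq> modes H \<times> Pow (valuations (variables H)) \<times> actions H
       \<times> Pow (valuations (variables H) \<times> valuations (variables H)) \<times> modes H \<and>
     (\<forall>m\<in>modes H. invariant H m \<subseteq> valuations (variables H)) \<and>
     (\<forall>m\<in>modes H. flow H m \<in> valuations (variables H) \<rightarrow> valuations (variables H) \<and>
        lipschitz_field (variables H) (flow H m)) \<and>
     initial_valuations H \<subseteq> valuations (variables H)"

definition ode_solution ::
  "'x set \<Rightarrow> (('x \<Rightarrow> real) \<Rightarrow> ('x \<Rightarrow> real)) \<Rightarrow> ('x \<Rightarrow> real) \<Rightarrow> (real \<Rightarrow> 'x \<Rightarrow> real) \<Rightarrow> bool" where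
  "ode_solution X f \<nu> u \<longleftrightarrow> u 0 = \<nu> \<and>
     (\<forall>t\<ge>0. u t \<in> valuations X \<and>
        (\<forall>x\<in>X. ((\<lambda>s. u s x) has_real_derivative f (u t) x) (at t within {0..})))"

definition advance ::
  "'x set \<Rightarrow> (('x \<Rightarrow> real) \<Rightarrow> ('x \<Rightarrow> real)) \<Rightarrow> ('x \<Rightarrow> real) \<Rightarrow> real \<Rightarrow> ('x \<Rightarrow> real)" where
  "advance X f \<nu> t = (THE \<mu>. \<exists>u. ode_solution X f \<nu> u \<and> u t = \<mu>)"

definition configurations :: "('m, 'a, 'x) hybrid_automaton \<Rightarrow> ('m \<times> ('x \<Rightarrow> real)) set" where
  "configurations H =
     {(m, \<nu>). m \<in> modes H \<and> \<nu> \<in> valuations (variables H) \<and> \<nu> \<in> invariant H m}"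

definition initial_configurations ::
  "('m, 'a, 'x) hybrid_automaton \<Rightarrow> ('m \<times> ('x \<Rightarrow> real)) set" where
  "initial_configurations H =
     {(m, \<nu>) \<in> configurations H. m \<in> initial_modes H \<and> \<nu> \<in> initial_valuations H}"

definition step :: "('m, 'a, 'x) hybrid_automaton \<Rightarrow> 'm \<times> ('x \<Rightarrow> real) \<Rightarrow> real \<times> 'a \<Rightarrow>
    'm \<times> ('x \<Rightarrow> real) \<Rightarrow> bool" where
  "step H = (\<lambda>(m, \<nu>) (t, a) (m', \<nu>').
     (m, \<nu>) \<in> configurations H \<and> (m', \<nu>') \<in> configurations H \<and> t \<ge> 0 \<and>
     (\<exists>g j. (m, g, a, j, m') \<in> transitions H \<and>
        advance (variables H) (flow H m) \<nu> t \<in> g \<and>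
        (\<forall>\<tau>\<in>{0..t}. advance (variables H) (flow H m) \<nu> \<tau> \<in> invariant H m) \<and>
        (advance (variables H) (flow H m) \<nu> t, \<nu>') \<in> j))"

text \<open>In an infinite run, \<open>c i\<close> is the configuration with index \<open>i\<close>, and \<open>l i\<close> labels the transition
  from \<open>c i\<close> to \<open>c (Suc i)\<close>.\<close>

definition infinite_run :: "('m, 'a, 'x) hybrid_automaton \<Rightarrow> (nat \<Rightarrow> 'm \<times> ('x \<Rightarrow> real)) \<Rightarrow>
    (nat \<Rightarrow> real \<times> 'a) \<Rightarrow> bool" where
  "infinite_run H c l \<longleftrightarrow>
     c 0 \<in> initial_configurations H \<and> (\<forall>i. step H (c i) (l i) (c (Suc i)))"


section \<open>Hybrid Kripke structures and LTL\<close>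

type_synonym ('m, 'a, 'x, 'p) hybrid_kripke =
  "('m, 'a, 'x) hybrid_automaton \<times> 'p set \<times> ('m \<Rightarrow> 'p set)"

definition wf_hybrid_kripke :: "('m, 'a, 'x, 'p) hybrid_kripke \<Rightarrow> bool" where
  "wf_hybrid_kripke = (\<lambda>(H, P, L).
     wf_hybrid_automaton H \<and> finite P \<and> (\<forall>m\<in>modes H. L m \<subseteq> P))"

definition traces :: "('m, 'a, 'x, 'p) hybrid_kripke \<Rightarrow> (nat \<Rightarrow> 'p set) set" where
  "traces = (\<lambda>(H, P, L). {(\<lambda>i. L (fst (c i))) | c l. infinite_run H c l})"

datatype (atoms: 'p) ltl =
    LTrue
  | LFalse
  | Prop 'p
  | LNot "'p ltl"
  | LAnd "'p ltl" "'p ltl"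
  | LOr "'p ltl" "'p ltl"
  | Next "'p ltl"
  | Diamond "'p ltl"
  | Box "'p ltl"
  | Until "'p ltl" "'p ltl"

definition suffix_from :: "(nat \<Rightarrow> 'b) \<Rightarrow> nat \<Rightarrow> nat \<Rightarrow> 'b" where
  "suffix_from \<sigma> i = (\<lambda>k. \<sigma> (i + k))"

primrec sat :: "(nat \<Rightarrow> 'p set) \<Rightarrow> 'p ltl \<Rightarrow> bool" where
  "sat \<sigma> LTrue \<longleftrightarrow> True"
| "sat \<sigma> LFalse \<longleftrightarrow> False"
| "sat \<sigma> (Prop p) \<longleftrightarrow> p \<in> \<sigma> 0"
| "sat \<sigma> (LNot \<phi>) \<longleftrightarrow> \<not> sat \<sigma> \<phi>"
| "sat \<sigma> (LAnd \<phi> \<psi>) \<longleftrightarrow> sat \<sigma> \<phi> \<and> sat \<sigma> \<psi>"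
| "sat \<sigma> (LOr \<phi> \<psi>) \<longleftrightarrow> sat \<sigma> \<phi> \<or> sat \<sigma> \<psi>"
| "sat \<sigma> (Next \<phi>) \<longleftrightarrow> sat (suffix_from \<sigma> 1) \<phi>"
| "sat \<sigma> (Diamond \<phi>) \<longleftrightarrow> (\<exists>i. sat (suffix_from \<sigma> i) \<phi>)"
| "sat \<sigma> (Box \<phi>) \<longleftrightarrow> (\<forall>i. sat (suffix_from \<sigma> i) \<phi>)"
| "sat \<sigma> (Until \<phi> \<psi>) \<longleftrightarrow>
     (\<exists>i. sat (suffix_from \<sigma> i) \<psi> \<and> (\<forall>j<i. sat (suffix_from \<sigma> j) \<phi>))"

definition kripke_models :: "('m, 'a, 'x, 'p) hybrid_kripke \<Rightarrow> 'p ltl \<Rightarrow> bool" where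
  "kripke_models K \<phi> \<longleftrightarrow> (\<forall>\<sigma>\<in>traces K. sat \<sigma> \<phi>)"


section \<open>Computer-readable presentations\<close>

text \<open>Predicates are presented by Boolean combinations of polynomial equations and inequalities with
  rational coefficients, and flows by one polynomial for each variable. Modes, actions, variables
  and propositions are initial segments of the natural numbers.\<close>

datatype (term_vars: 'v) tm =
    Const rat
  | Var 'v
  | Add "'v tm" "'v tm"
  | Mul "'v tm" "'v tm"

datatype (pred_vars: 'v) fm =
    Eq "'v tm" "'v tm"
  | Less "'v tm" "'v tm"
  | Neg "'v fm"
  | And "'v fm" "'v fm"
  | Or "'v fm" "'v fm"

primrec term_value :: "('v \<Rightarrow> real) \<Rightarrow> 'v tm \<Rightarrow> real" where
  "term_value e (Const q) = of_rat q"
| "term_value e (Var v) = e v"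
| "term_value e (Add s t) = term_value e s + term_value e t"
| "term_value e (Mul s t) = term_value e s * term_value e t"

primrec holds :: "('v \<Rightarrow> real) \<Rightarrow> 'v fm \<Rightarrow> bool" where
  "holds e (Eq s t) \<longleftrightarrow> term_value e s = term_value e t"
| "holds e (Less s t) \<longleftrightarrow> term_value e s < term_value e t"
| "holds e (Neg p) \<longleftrightarrow> \<not> holds e p"
| "holds e (And p q) \<longleftrightarrow> holds e p \<and> holds e q"
| "holds e (Or p q) \<longleftrightarrow> holds e p \<or> holds e q"

text \<open>A mode is given by its invariant, its flow (the list of the right-hand sides) and its label;
  an edge by source, guard, action, jump predicate and target. In jump predicates \<open>Inl x\<close> stands for
  the variable \<open>x\<close> and \<open>Inr x\<close> for its primed copy.\<close>

type_synonym mode_presentation = "nat fm \<times> nat tm list \<times> nat list"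
type_synonym edge_presentation = "nat \<times> nat fm \<times> nat \<times> (nat + nat) fm \<times> nat"

record presentation =
  num_actions :: nat
  num_vars :: nat
  num_props :: nat
  start_modes :: "nat list"
  mode_list :: "mode_presentation list"
  edge_list :: "edge_presentation list"
  start_pred :: "nat fm"

definition pred_of :: "nat \<Rightarrow> nat fm \<Rightarrow> (nat \<Rightarrow> real) set" where
  "pred_of n p = {\<nu> \<in> valuations {..<n}. holds \<nu> p}"

definition jump_of :: "nat \<Rightarrow> (nat + nat) fm \<Rightarrow> ((nat \<Rightarrow> real) \<times> (nat \<Rightarrow> real)) set" where
  "jump_of n p =
     {(\<nu>, \<nu>') \<in> valuations {..<n} \<times> valuations {..<n}. holds (case_sum \<nu> \<nu>') p}"

definition field_of :: "nat \<Rightarrow> nat tm list \<Rightarrow> (nat \<Rightarrow> real) \<Rightarrow> (nat \<Rightarrow> real)" where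
  "field_of n ts \<nu> = (\<lambda>x\<in>{..<n}. term_value \<nu> (ts ! x))"

definition automaton_of :: "presentation \<Rightarrow> (nat, nat, nat) hybrid_automaton" where
  "automaton_of d = (let n = num_vars d in
     \<lparr> modes = {..<length (mode_list d)},
       initial_modes = set (start_modes d),
       actions = {..<num_actions d},
       variables = {..<n},
       transitions =
         (\<lambda>(m, g, a, j, m'). (m, pred_of n g, a, jump_of n j, m')) ` set (edge_list d),
       invariant = (\<lambda>m. pred_of n (fst (mode_list d ! m))),
       flow = (\<lambda>m. field_of n (fst (snd (mode_list d ! m)))),
       initial_valuations = pred_of n (start_pred d) \<rparr>)"

definition kripke_of :: "presentation \<Rightarrow> (nat, nat, nat, nat) hybrid_kripke" where
  "kripke_of d =
     (automaton_of d, {..<num_props d}, \<lambda>m. set (snd (snd (mode_list d ! m))))"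

text \<open>The syntactic conditions ensure that a presentation only mentions declared variables; the
  remaining constraints, including Lipschitz continuity of the flows, are those of
  \<^const>\<open>wf_hybrid_kripke\<close>.\<close>

definition wf_presentation :: "presentation \<Rightarrow> bool" where
  "wf_presentation d \<longleftrightarrow>
     (\<forall>(p, ts, ps)\<in>set (mode_list d). pred_vars p \<subseteq> {..<num_vars d} \<and>
        length ts = num_vars d \<and> (\<forall>t\<in>set ts. term_vars t \<subseteq> {..<num_vars d})) \<and>
     (\<forall>(m, g, a, j, m')\<in>set (edge_list d). pred_vars g \<subseteq> {..<num_vars d} \<and>
        pred_vars j \<subseteq> {..<num_vars d} <+> {..<num_vars d}) \<and>
     pred_vars (start_pred d) \<subseteq> {..<num_vars d} \<and>
     wf_hybrid_kripke (kripke_of d)"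


section \<open>Encoding by natural numbers\<close>

definition encode_rat :: "rat \<Rightarrow> nat" where
  "encode_rat q =
     prod_encode (int_encode (fst (quotient_of q)), int_encode (snd (quotient_of q)))"

primrec encode_tm :: "('v \<Rightarrow> nat) \<Rightarrow> 'v tm \<Rightarrow> nat" where
  "encode_tm e (Const q) = prod_encode (0, encode_rat q)"
| "encode_tm e (Var v) = prod_encode (1, e v)"
| "encode_tm e (Add s t) = prod_encode (2, prod_encode (encode_tm e s, encode_tm e t))"
| "encode_tm e (Mul s t) = prod_encode (3, prod_encode (encode_tm e s, encode_tm e t))"

primrec encode_fm :: "('v \<Rightarrow> nat) \<Rightarrow> 'v fm \<Rightarrow> nat" where
  "encode_fm e (Eq s t) = prod_encode (0, prod_encode (encode_tm e s, encode_tm e t))"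
| "encode_fm e (Less s t) = prod_encode (1, prod_encode (encode_tm e s, encode_tm e t))"
| "encode_fm e (Neg p) = prod_encode (2, encode_fm e p)"
| "encode_fm e (And p q) = prod_encode (3, prod_encode (encode_fm e p, encode_fm e q))"
| "encode_fm e (Or p q) = prod_encode (4, prod_encode (encode_fm e p, encode_fm e q))"

primrec encode_ltl :: "nat ltl \<Rightarrow> nat" where
  "encode_ltl LTrue = prod_encode (0, 0)"
| "encode_ltl LFalse = prod_encode (1, 0)"
| "encode_ltl (Prop p) = prod_encode (2, p)"
| "encode_ltl (LNot \<phi>) = prod_encode (3, encode_ltl \<phi>)"
| "encode_ltl (LAnd \<phi> \<psi>) = prod_encode (4, prod_encode (encode_ltl \<phi>, encode_ltl \<psi>))"
| "encode_ltl (LOr \<phi> \<psi>) = prod_encode (5, prod_encode (encode_ltl \<phi>, encode_ltl \<psi>))"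
| "encode_ltl (Next \<phi>) = prod_encode (6, encode_ltl \<phi>)"
| "encode_ltl (Diamond \<phi>) = prod_encode (7, encode_ltl \<phi>)"
| "encode_ltl (Box \<phi>) = prod_encode (8, encode_ltl \<phi>)"
| "encode_ltl (Until \<phi> \<psi>) = prod_encode (9, prod_encode (encode_ltl \<phi>, encode_ltl \<psi>))"

definition encode_mode :: "mode_presentation \<Rightarrow> nat" where
  "encode_mode = (\<lambda>(p, ts, ps).
     list_encode [encode_fm id p, list_encode (map (encode_tm id) ts), list_encode ps])"

definition encode_edge :: "edge_presentation \<Rightarrow> nat" where
  "encode_edge = (\<lambda>(m, g, a, j, m').
     list_encode [m, encode_fm id g, a, encode_fm sum_encode j, m'])"

definition encode_presentation :: "presentation \<Rightarrow> nat" where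
  "encode_presentation d = list_encode
     [num_actions d, num_vars d, num_props d, list_encode (start_modes d),
      list_encode (map encode_mode (mode_list d)), list_encode (map encode_edge (edge_list d)),
      encode_fm id (start_pred d)]"

definition encode_instance :: "presentation \<times> nat ltl \<Rightarrow> nat" where
  "encode_instance = (\<lambda>(d, \<phi>). prod_encode (encode_presentation d, encode_ltl \<phi>))"

text \<open>The encoding is injective, so undecidability is not an artefact of two instances sharing a
  code.\<close>

lemma inj_encode_rat: "inj encode_rat"
  by (auto simp: inj_def encode_rat_def int_encode_eq intro: quotient_of_inject prod_eqI)

lemma inj_encode_tm:
  assumes "inj e" shows "inj (encode_tm e)"
proof (rule injI)
  fix s t assume "encode_tm e s = encode_tm e t"
  then show "s = t"
  proof (induction s arbitrary: t)
    case (Const q) then show ?case by (cases t) (auto dest: injD[OF inj_encode_rat])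
  next
    case (Var v) then show ?case by (cases t) (auto dest: injD[OF assms])
  next
    case (Add s1 s2) then show ?case by (cases t) auto
  next
    case (Mul s1 s2) then show ?case by (cases t) auto
  qed
qed

lemma inj_encode_fm:
  assumes "inj e" shows "inj (encode_fm e)"
proof (rule injI)
  fix p q assume "encode_fm e p = encode_fm e q"
  then show "p = q"
  proof (induction p arbitrary: q)
    case (Eq s t) then show ?case by (cases q) (auto dest: injD[OF inj_encode_tm[OF assms]])
  next
    case (Less s t) then show ?case by (cases q) (auto dest: injD[OF inj_encode_tm[OF assms]])
  next
    case (Neg p) then show ?case by (cases q) auto
  next
    case (And p1 p2) then show ?case by (cases q) auto
  next
    case (Or p1 p2) then show ?case by (cases q) auto
  qed
qed

lemma inj_encode_ltl: "inj encode_ltl"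
proof (rule injI)
  fix \<phi> \<psi> assume "encode_ltl \<phi> = encode_ltl \<psi>"
  then show "\<phi> = \<psi>"
    by (induction \<phi> arbitrary: \<psi>) (case_tac \<psi>; auto)+
qed

lemma inj_encode_mode: "inj encode_mode"
  by (auto simp: inj_def encode_mode_def list_encode_eq
      dest: injD[OF inj_encode_fm[OF inj_on_id]] map_injective[OF _ inj_encode_tm[OF inj_on_id]])

lemma inj_encode_edge: "inj encode_edge"
  by (auto simp: inj_def encode_edge_def list_encode_eq
      dest: injD[OF inj_encode_fm[OF inj_on_id]] injD[OF inj_encode_fm[OF inj_sum_encode]])

lemma inj_encode_presentation: "inj encode_presentation"
  by (auto simp: inj_def encode_presentation_def list_encode_eq intro!: presentation.equality
      dest: injD[OF inj_encode_fm[OF inj_on_id]] map_injective[OF _ inj_encode_mode]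
        map_injective[OF _ inj_encode_edge])

lemma inj_encode_instance: "inj encode_instance"
  by (auto simp: inj_def encode_instance_def
      dest: injD[OF inj_encode_presentation] injD[OF inj_encode_ltl])


section \<open>Programs and decidability\<close>

text \<open>Programs are descriptions of partial recursive functions, with a big-step semantics:
  \<open>evaluates p xs y\<close> means that \<open>p\<close> terminates on input \<open>xs\<close> with output \<open>y\<close>.\<close>

datatype program =
    Zero
  | Succ
  | Proj nat
  | Comp program "program list"
  | PrimRec program program
  | Minimise program

inductive evaluates :: "program \<Rightarrow> nat list \<Rightarrow> nat \<Rightarrow> bool" where
  zero: "evaluates Zero xs 0"
| succ: "evaluates Succ [x] (Suc x)"
| proj: "i < length xs \<Longrightarrow> evaluates (Proj i) xs (xs ! i)"
| comp: "list_all2 (\<lambda>q y. evaluates q xs y) qs ys \<Longrightarrow> evaluates p ys z \<Longrightarrow>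
    evaluates (Comp p qs) xs z"
| rec_0: "evaluates p xs y \<Longrightarrow> evaluates (PrimRec p q) (0 # xs) y"
| rec_Suc: "evaluates (PrimRec p q) (n # xs) r \<Longrightarrow> evaluates q (n # r # xs) y \<Longrightarrow>
    evaluates (PrimRec p q) (Suc n # xs) y"
| minimise: "evaluates p (n # xs) 0 \<Longrightarrow> (\<forall>i<n. \<exists>y. evaluates p (i # xs) (Suc y)) \<Longrightarrow>
    evaluates (Minimise p) xs n"

inductive_cases evaluates_ZeroE: "evaluates Zero xs y"
inductive_cases evaluates_SuccE: "evaluates Succ xs y"
inductive_cases evaluates_ProjE: "evaluates (Proj i) xs y"
inductive_cases evaluates_CompE: "evaluates (Comp p qs) xs y"
inductive_cases evaluates_rec_0E: "evaluates (PrimRec p q) (0 # xs) y"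
inductive_cases evaluates_rec_SucE: "evaluates (PrimRec p q) (Suc n # xs) y"
inductive_cases evaluates_MinimiseE: "evaluates (Minimise p) xs y"

lemma evaluates_deterministic:
  "evaluates p xs y \<Longrightarrow> evaluates p xs z \<Longrightarrow> y = z"
proof (induction arbitrary: z rule: evaluates.induct)
  case (zero xs) then show ?case by (auto elim: evaluates_ZeroE)
next
  case (succ x) then show ?case by (auto elim: evaluates_SuccE)
next
  case (proj i xs) then show ?case by (auto elim: evaluates_ProjE)
next
  case (comp xs qs ys p z z')
  from comp.prems obtain ys' where
    ys': "list_all2 (\<lambda>q y. evaluates q xs y) qs ys'" "evaluates p ys' z'"
    by (rule evaluates_CompE)
  have "ys = ys'"
  proof (rule nth_equalityI)
    show "length ys = length ys'"
      using list_all2_lengthD[OF comp.IH(1)] list_all2_lengthD[OF ys'(1)] by simp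
  next
    fix i assume "i < length ys"
    then have i: "i < length qs" using list_all2_lengthD[OF comp.IH(1)] by simp
    from list_all2_nthD[OF ys'(1) i] list_all2_nthD[OF comp.IH(1) i]
    show "ys ! i = ys' ! i" by blast
  qed
  with ys'(2) have "evaluates p ys z'" by simp
  then show ?case by (rule comp.IH(2))
next
  case (rec_0 p xs y q)
  from rec_0.prems have "evaluates p xs z" by (rule evaluates_rec_0E)
  then show ?case by (rule rec_0.IH)
next
  case (rec_Suc p q n xs r y)
  from rec_Suc.prems obtain r' where r': "evaluates (PrimRec p q) (n # xs) r'"
    "evaluates q (n # r' # xs) z" by (rule evaluates_rec_SucE)
  from rec_Suc.IH(1)[OF r'(1)] r'(2) have "evaluates q (n # r # xs) z" by simp
  then show ?case by (rule rec_Suc.IH(2))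
next
  case (minimise p n xs z)
  from minimise.prems have z: "evaluates p (z # xs) 0"
    "\<forall>i<z. \<exists>y. evaluates p (i # xs) (Suc y)"
    by (blast elim: evaluates_MinimiseE)+
  have "\<not> n < z"
  proof
    assume "n < z"
    with z(2) obtain y where "evaluates p (n # xs) (Suc y)" by blast
    from minimise.IH(1)[OF this] show False by simp
  qed
  moreover have "\<not> z < n"
  proof
    assume "z < n"
    with minimise.IH(2) obtain y where "\<forall>w. evaluates p (z # xs) w \<longrightarrow> Suc y = w" by blast
    with z(1) have "Suc y = 0" by blast
    then show False by simp
  qed
  ultimately show ?case by simp
qed

text \<open>A problem consists of a set \<open>D\<close> of instances and a yes/no question \<open>Q\<close> about them. A decision
  program must terminate with the correct answer on all instances; its behaviour on numbers that
  encode no instance is irrelevant.\<close>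

definition decidable :: "('i \<Rightarrow> nat) \<Rightarrow> 'i set \<Rightarrow> ('i \<Rightarrow> bool) \<Rightarrow> bool" where
  "decidable enc D Q \<longleftrightarrow> (\<exists>p. \<forall>i\<in>D. evaluates p [enc i] (if Q i then 1 else 0))"

definition model_checking_instances :: "(presentation \<times> nat ltl) set" where
  "model_checking_instances = {(d, \<phi>). wf_presentation d \<and> atoms \<phi> \<subseteq> {..<num_props d}}"

end

theory Submission
  imports Defs
begin

text \<open>Given a program \<open>p\<close> that decides the problem, we build a hybrid automaton that simulates \<open>p\<close>
  on the automaton's own code and reaches an accepting mode iff the answer is \<open>1\<close>, that is, iff \<open>p\<close>
  claims that the accepting mode is never reached. Register machines are simulated with flow \<open>0\<close>, one
  mode for each program counter, and polynomial jumps. Self-reference needs neither a universal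
  program nor a computable compiler: the parts of the code that depend on \<open>p\<close> are fixed once the
  machine is fixed, and they are handed to the machine as initial values of its input registers. The
  code of the initial predicate can in turn be computed from these values. Since \<open>p\<close> terminates on the
  instance, the compiler only has to be correct for terminating computations.\<close>

section \<open>Register machines\<close>

text \<open>Operands are terms of presentations, so that a test becomes a guard and an assignment a
  polynomial jump. Registers hold reals because they become the variables of the automaton.\<close>

datatype instr =
    Assign nat "nat tm"
  | Branch "nat tm" "nat tm" nat
  | Jump nat

primrec exec :: "instr \<Rightarrow> nat \<times> (nat \<Rightarrow> real) \<Rightarrow> nat \<times> (nat \<Rightarrow> real)" where
  "exec (Assign r t) c = (Suc (fst c), (snd c)(r := term_value (snd c) t))"
| "exec (Branch s t k) c =
     (if term_value (snd c) s = term_value (snd c) t then k else Suc (fst c), snd c)"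
| "exec (Jump k) c = (k, snd c)"

text \<open>Beyond the end of the code the machine loops forever, since only infinite runs have traces.\<close>

definition fetch :: "instr list \<Rightarrow> nat \<Rightarrow> instr" where
  "fetch code l = (if l < length code then code ! l else Jump l)"

definition machine_step :: "instr list \<Rightarrow> nat \<times> (nat \<Rightarrow> real) \<Rightarrow> nat \<times> (nat \<Rightarrow> real)" where
  "machine_step code c = exec (fetch code (fst c)) c"

definition reaches ::
  "instr list \<Rightarrow> nat \<times> (nat \<Rightarrow> real) \<Rightarrow> nat \<times> (nat \<Rightarrow> real) \<Rightarrow> bool" where
  "reaches code c c' \<longleftrightarrow> (\<exists>k. (machine_step code ^^ k) c = c')"

lemma reaches_refl: "reaches code c c"
  unfolding reaches_def by (rule exI[of _ 0]) simp

lemma reaches_trans [trans]: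
  assumes "reaches code c c'" "reaches code c' c''" shows "reaches code c c''"
proof -
  from assms obtain k k' where "(machine_step code ^^ k) c = c'" "(machine_step code ^^ k') c' = c''"
    by (auto simp: reaches_def)
  then have "(machine_step code ^^ (k' + k)) c = c''" by (simp add: funpow_add)
  then show ?thesis by (auto simp: reaches_def)
qed

lemma reaches_step: "machine_step code c = c' \<Longrightarrow> reaches code c c'"
  unfolding reaches_def by (rule exI[of _ 1]) simp

lemma funpow_fixed: "f c = c \<Longrightarrow> (f ^^ k) c = c"
  by (induction k) auto

text \<open>The machine is deterministic: after \<open>k1 + k2\<close> steps it rests in both fixed
  configurations.\<close>

lemma reaches_fixed_unique:
  assumes "reaches code c c1" "machine_step code c1 = c1"
    and "reaches code c c2" "machine_step code c2 = c2"
  shows "c1 = c2"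
proof -
  from assms obtain k1 k2 where k: "(machine_step code ^^ k1) c = c1" "(machine_step code ^^ k2) c = c2"
    by (auto simp: reaches_def)
  have "(machine_step code ^^ (k2 + k1)) c = c1"
    using k assms by (simp add: funpow_add funpow_fixed)
  moreover have "(machine_step code ^^ (k1 + k2)) c = c2"
    using k assms by (simp add: funpow_add funpow_fixed)
  ultimately show ?thesis by (simp add: add.commute)
qed

text \<open>Jump targets are absolute, so a fragment is correct only relative to its position inside
  the whole code.\<close>

definition placed :: "instr list \<Rightarrow> nat \<Rightarrow> instr list \<Rightarrow> bool" where
  "placed code s cs \<longleftrightarrow> (\<forall>i<length cs. s + i < length code \<and> code ! (s + i) = cs ! i)"

lemma placed_Nil [simp]: "placed code s []"
  by (simp add: placed_def)

lemma placed_Cons [simp]: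
  "placed code s (c # cs) \<longleftrightarrow> s < length code \<and> code ! s = c \<and> placed code (Suc s) cs"
  by (auto simp: placed_def All_less_Suc2)

lemma placed_append [simp]:
  "placed code s (cs @ ds) \<longleftrightarrow> placed code s cs \<and> placed code (s + length cs) ds"
  by (induction cs arbitrary: s) auto

lemma machine_step_placed:
  "l < length code \<Longrightarrow> code ! l = i \<Longrightarrow> machine_step code (l, \<nu>) = exec i (l, \<nu>)"
  by (simp add: machine_step_def fetch_def)

section \<open>Compiling programs to register machines\<close>

text \<open>\<open>compile p is r b s\<close> is code to be placed at position \<open>s\<close>: it reads the registers \<open>is\<close>, puts the
  result into register \<open>r\<close>, and uses the registers from \<open>b\<close> on as scratch space.\<close>

fun compile :: "program \<Rightarrow> nat list \<Rightarrow> nat \<Rightarrow> nat \<Rightarrow> nat \<Rightarrow> instr list"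
  and compile_list :: "program list \<Rightarrow> nat list \<Rightarrow> nat \<Rightarrow> nat \<Rightarrow> nat \<Rightarrow> instr list" where
  "compile Zero is r b s = [Assign r (Const 0)]"
| "compile Succ is r b s = [Assign r (Add (Var (hd is)) (Const 1))]"
| "compile (Proj i) is r b s = [Assign r (Var (is ! i))]"
| "compile (Comp p qs) is r b s =
     (let k = b + length qs; cs = compile_list qs is b k s
      in cs @ compile p [b..<k] r k (s + length cs))"
| "compile (PrimRec p q) is r b s =
     (let cs = compile p (tl is) (b + 1) (b + 3) (s + 1);
          l = s + 1 + length cs;
          ds = compile q (b # (b + 1) # tl is) (b + 2) (b + 3) (l + 1)
      in Assign b (Const 0) # cs @ Branch (Var b) (Var (hd is)) (l + length ds + 4) # ds @
         [Assign (b + 1) (Var (b + 2)), Assign b (Add (Var b) (Const 1)), Jump l,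
          Assign r (Var (b + 1))])"
| "compile (Minimise p) is r b s =
     (let l = s + 1; cs = compile p (b # is) (b + 1) (b + 2) l
      in Assign b (Const 0) # cs @
         [Branch (Var (b + 1)) (Const 0) (l + length cs + 3), Assign b (Add (Var b) (Const 1)),
          Jump l, Assign r (Var b)])"
| "compile_list [] is r b s = []"
| "compile_list (q # qs) is r b s =
     (let cs = compile q is r b s in cs @ compile_list qs is (Suc r) b (s + length cs))"

section \<open>Correctness of the compiler\<close>

definition agree_below :: "nat \<Rightarrow> (nat \<Rightarrow> real) \<Rightarrow> (nat \<Rightarrow> real) \<Rightarrow> bool" where
  "agree_below b \<nu> \<nu>' \<longleftrightarrow> (\<forall>r<b. \<nu>' r = \<nu> r)"

lemma agree_below_map:
  "agree_below b \<nu> \<nu>' \<Longrightarrow> set is \<subseteq> {..<b} \<Longrightarrow> map \<nu>' is = map \<nu> is"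
  by (auto simp: agree_below_def)

definition computes_into :: "instr list \<Rightarrow> nat \<Rightarrow> nat \<Rightarrow> nat \<Rightarrow> nat \<Rightarrow> nat \<Rightarrow> (nat \<Rightarrow> real) \<Rightarrow> bool" where
  "computes_into code s e r b y \<nu> \<longleftrightarrow>
     (\<exists>\<nu>'. reaches code (s, \<nu>) (e, \<nu>') \<and> \<nu>' r = real y \<and> (\<forall>x<b. x \<noteq> r \<longrightarrow> \<nu>' x = \<nu> x))"

lemma computes_intoE:
  assumes "computes_into code s e r b y \<nu>"
  obtains \<nu>' where "reaches code (s, \<nu>) (e, \<nu>')" "\<nu>' r = real y" "\<And>x. x < b \<Longrightarrow> x \<noteq> r \<Longrightarrow> \<nu>' x = \<nu> x"
  using assms by (auto simp: computes_into_def)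

text \<open>Unwinding the recursion yields the intermediate values \<open>f 0\<close>, ...,
  \<open>f n\<close>, which the compiled loop passes through one after the other.\<close>

lemma evaluates_PrimRec_sequence:
  assumes "evaluates (PrimRec p q) (n # xs) y"
  obtains f where "evaluates p xs (f 0)" "\<And>i. i < n \<Longrightarrow> evaluates q (i # f i # xs) (f (Suc i))" "f n = y"
proof -
  from assms have "\<exists>f. evaluates p xs (f 0) \<and> (\<forall>i<n. evaluates q (i # f i # xs) (f (Suc i))) \<and> f n = y"
  proof (induction n arbitrary: y)
    case 0
    then show ?case by (auto elim: evaluates_rec_0E)
  next
    case (Suc n)
    from Suc.prems obtain z where z: "evaluates (PrimRec p q) (n # xs) z" "evaluates q (n # z # xs) y"
      by (rule evaluates_rec_SucE)
    from Suc.IH[OF z(1)] obtain f where "evaluates p xs (f 0)"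
      "\<forall>i<n. evaluates q (i # f i # xs) (f (Suc i))" "f n = z" by blast
    with z(2) show ?case
      by (intro exI[of _ "f(Suc n := y)"]) (auto simp: less_Suc_eq)
  qed
  with that show thesis by blast
qed

text \<open>Mutual induction along the recursion of the compiler. A single program may have its
  result register among its inputs, since that register is written last; in a list the inputs lie
  below all result registers, because later programs still read them.\<close>

lemma compile_correct:
  "evaluates p xs y \<Longrightarrow> placed code s (compile p is r b s) \<Longrightarrow> map \<nu> is = map real xs \<Longrightarrow>
     set is \<subseteq> {..<b} \<Longrightarrow> r < b \<Longrightarrow>
     computes_into code s (s + length (compile p is r b s)) r b y \<nu>"
  "list_all2 (\<lambda>q y. evaluates q xs y) qs ys \<Longrightarrow> placed code s (compile_list qs is r b s) \<Longrightarrow>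
     map \<nu> is = map real xs \<Longrightarrow> set is \<subseteq> {..<r} \<Longrightarrow> r + length qs \<le> b \<Longrightarrow>
     \<exists>\<nu>'. reaches code (s, \<nu>) (s + length (compile_list qs is r b s), \<nu>') \<and>
       map \<nu>' [r..<r + length qs] = map real ys \<and> agree_below r \<nu> \<nu>'"
proof (induction p "is" r b s and qs "is" r b s arbitrary: xs y \<nu> and xs ys \<nu>
    rule: compile_compile_list.induct)
  case (1 "is" r b s)
  then show ?case
    by (auto simp: computes_into_def machine_step_placed elim!: evaluates_ZeroE intro!: exI reaches_step)
next
  case (2 "is" r b s)
  then show ?case
    by (auto simp: computes_into_def machine_step_placed elim!: evaluates_SuccE intro!: exI reaches_step)
next
  case (3 i "is" r b s)
  then have "\<nu> (is ! i) = real (xs ! i)" "y = xs ! i"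
    by (auto elim!: evaluates_ProjE) (metis length_map nth_map)
  with 3 show ?case
    by (auto simp: computes_into_def machine_step_placed intro!: exI reaches_step)
next
  case (4 p qs "is" r b s)
  \<comment> \<open>The inner results occupy the registers from \<open>b\<close> to
    \<open>?k - 1\<close>, where \<open>p\<close> reads its inputs, so the scratch space of
    \<open>p\<close> starts at \<open>?k\<close>.\<close>
  let ?k = "b + length qs"
  let ?cs = "compile_list qs is b ?k s"
  let ?ds = "compile p [b..<?k] r ?k (s + length ?cs)"
  from 4(3) obtain ys where ys: "list_all2 (\<lambda>q y. evaluates q xs y) qs ys" "evaluates p ys y"
    by (rule evaluates_CompE)
  have pl: "placed code s ?cs" "placed code (s + length ?cs) ?ds"
    using 4(4) by (simp_all add: Let_def)
  obtain \<nu>1 where \<nu>1: "reaches code (s, \<nu>) (s + length ?cs, \<nu>1)" "map \<nu>1 [b..<?k] = map real ys"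
    "agree_below b \<nu> \<nu>1"
    using 4(1)[OF refl ys(1) pl(1) 4(5,6)] by auto
  have "computes_into code (s + length ?cs) (s + length ?cs + length ?ds) r ?k y \<nu>1"
    by (rule 4(2)[OF refl refl ys(2) pl(2) \<nu>1(2)]) (use 4(7) in auto)
  then obtain \<nu>2 where \<nu>2: "reaches code (s + length ?cs, \<nu>1) (s + length ?cs + length ?ds, \<nu>2)"
    "\<nu>2 r = real y" "\<And>x. x < ?k \<Longrightarrow> x \<noteq> r \<Longrightarrow> \<nu>2 x = \<nu>1 x"
    by (rule computes_intoE) blast
  show ?case
    unfolding computes_into_def
    using reaches_trans[OF \<nu>1(1) \<nu>2(1)] \<nu>2(2,3) \<nu>1(3)
    by (auto simp: Let_def agree_below_def add.assoc intro!: exI[of _ \<nu>2])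
next
  case (5 p q "is" r b s)
  \<comment> \<open>Register \<open>b\<close> counts iterations, \<open>b + 1\<close> holds the
    current value and \<open>b + 2\<close> receives the next one. The loop head is
    \<open>?l\<close>; the final assignment to \<open>r\<close> sits at \<open>?e\<close>.\<close>
  let ?cs = "compile p (tl is) (b + 1) (b + 3) (s + 1)"
  let ?l = "s + 1 + length ?cs"
  let ?ds = "compile q (b # (b + 1) # tl is) (b + 2) (b + 3) (?l + 1)"
  let ?e = "?l + length ?ds + 4"
  show ?case
  proof (cases xs)
    case Nil
    \<comment> \<open>No evaluation rule for primitive recursion accepts an empty input
      list.\<close>
    with 5(3) have False by (auto elim: evaluates.cases)
    then show ?thesis ..
  next
    case (Cons n zs)
    from 5(3)[unfolded Cons] obtain f where f: "evaluates p zs (f 0)"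
      "\<And>i. i < n \<Longrightarrow> evaluates q (i # f i # zs) (f (Suc i))" "f n = y"
      by (rule evaluates_PrimRec_sequence) blast
    from 5(5) Cons obtain h js where "is": "is = h # js" "\<nu> h = real n" "map \<nu> js = map real zs"
      by (cases "is") auto
    have hb: "h < b" "set js \<subseteq> {..<b}" using 5(6) "is" by auto
    have pl: "placed code s [Assign b (Const 0)]" "placed code (s + 1) ?cs"
      "placed code ?l [Branch (Var b) (Var h) ?e]" "placed code (?l + 1) ?ds"
      "placed code (?l + 1 + length ?ds) [Assign (b + 1) (Var (b + 2)),
         Assign b (Add (Var b) (Const 1)), Jump ?l, Assign r (Var (b + 1))]"
      using 5(4) by (simp_all add: Let_def "is" add.assoc)
    \<comment> \<open>Loop invariant at the head after \<open>i\<close> iterations. Agreement below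
      \<open>b\<close> protects the bound in \<open>h\<close> and the parameters in
      \<open>js\<close>.\<close>
    have loop: "\<exists>\<mu>. reaches code (s, \<nu>) (?l, \<mu>) \<and> \<mu> b = real i \<and> \<mu> (b + 1) = real (f i) \<and>
        agree_below b \<nu> \<mu>" if "i \<le> n" for i
      using that
    proof (induction i)
      case 0
      have s0: "reaches code (s, \<nu>) (s + 1, \<nu>(b := 0))"
        using pl(1) by (auto intro!: reaches_step simp: machine_step_placed)
      have "computes_into code (s + 1) (s + 1 + length ?cs) (b + 1) (b + 3) (f 0) (\<nu>(b := 0))"
      proof (rule 5(1)[OF f(1) pl(2)])
        show "map (\<nu>(b := 0)) (tl is) = map real zs"
          using "is" hb by (auto simp flip: "is"(3))
        show "set (tl is) \<subseteq> {..<b + 3}" using "is" hb by auto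
      qed auto
      then obtain \<mu> where \<mu>: "reaches code (s + 1, \<nu>(b := 0)) (?l, \<mu>)" "\<mu> (b + 1) = real (f 0)"
        "\<And>x. x < b + 3 \<Longrightarrow> x \<noteq> b + 1 \<Longrightarrow> \<mu> x = (\<nu>(b := 0)) x"
        by (rule computes_intoE) blast
      from reaches_trans[OF s0 \<mu>(1)] \<mu>(2,3) show ?case
        by (auto simp: agree_below_def intro!: exI[of _ \<mu>])
    next
      case (Suc i)
      then obtain \<mu> where \<mu>: "reaches code (s, \<nu>) (?l, \<mu>)" "\<mu> b = real i" "\<mu> (b + 1) = real (f i)"
        "agree_below b \<nu> \<mu>" by auto
      \<comment> \<open>As \<open>i < n\<close>, the counter has not met the bound and the exit
        branch is not taken.\<close>
      have "\<mu> h \<noteq> \<mu> b" using \<mu>(2,4) hb "is"(2) Suc.prems by (simp add: agree_below_def)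
      then have s1: "reaches code (?l, \<mu>) (?l + 1, \<mu>)"
        using pl(3) by (auto intro!: reaches_step simp: machine_step_placed)
      have "computes_into code (?l + 1) (?l + 1 + length ?ds) (b + 2) (b + 3) (f (Suc i)) \<mu>"
      proof (rule 5(2)[OF refl refl f(2) pl(4)])
        show "map \<mu> (b # (b + 1) # tl is) = map real (i # f i # zs)"
          using \<mu> "is" agree_below_map[OF \<mu>(4) hb(2)] by simp
        show "set (b # (b + 1) # tl is) \<subseteq> {..<b + 3}" using "is" hb by auto
      qed (use Suc.prems in auto)
      then obtain \<mu>' where \<mu>': "reaches code (?l + 1, \<mu>) (?l + 1 + length ?ds, \<mu>')"
        "\<mu>' (b + 2) = real (f (Suc i))"
        "\<And>x. x < b + 3 \<Longrightarrow> x \<noteq> b + 2 \<Longrightarrow> \<mu>' x = \<mu> x"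
        by (rule computes_intoE) blast
      define \<mu>1 where "\<mu>1 = \<mu>'(b + 1 := real (f (Suc i)))"
      define \<mu>2 where "\<mu>2 = \<mu>1(b := real (Suc i))"
      have s2: "reaches code (?l + 1 + length ?ds, \<mu>') (Suc (?l + 1 + length ?ds), \<mu>1)"
        using pl(5) \<mu>'(2) by (auto intro!: reaches_step simp: machine_step_placed \<mu>1_def)
      have "\<mu>1 b = real i" using \<mu>'(3)[of b] \<mu>(2) by (simp add: \<mu>1_def)
      then have s3: "reaches code (Suc (?l + 1 + length ?ds), \<mu>1) (Suc (Suc (?l + 1 + length ?ds)), \<mu>2)"
        using pl(5) by (auto intro!: reaches_step simp: machine_step_placed \<mu>2_def add.commute)
      have s4: "reaches code (Suc (Suc (?l + 1 + length ?ds)), \<mu>2) (?l, \<mu>2)"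
        using pl(5) by (auto intro!: reaches_step simp: machine_step_placed)
      have "reaches code (s, \<nu>) (?l, \<mu>2)"
        using \<mu>(1) s1 \<mu>'(1) s2 s3 s4 by (blast intro: reaches_trans)
      moreover have "agree_below b \<nu> \<mu>2"
        using \<mu>(4) \<mu>'(3) by (simp add: agree_below_def \<mu>2_def \<mu>1_def)
      moreover have "\<mu>2 b = real (Suc i)" "\<mu>2 (b + 1) = real (f (Suc i))"
        by (simp_all add: \<mu>2_def \<mu>1_def)
      ultimately show ?case by blast
    qed
    obtain \<mu> where \<mu>: "reaches code (s, \<nu>) (?l, \<mu>)" "\<mu> b = real n" "\<mu> (b + 1) = real y"
      "agree_below b \<nu> \<mu>" using loop[of n] f(3) by auto
    have "\<mu> h = \<mu> b" using \<mu> hb "is"(2) by (simp add: agree_below_def)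
    then have "reaches code (?l, \<mu>) (?e, \<mu>)"
      using pl(3) by (auto intro!: reaches_step simp: machine_step_placed)
    moreover have "reaches code (?e, \<mu>) (Suc ?e, \<mu>(r := real y))"
      using pl(5) \<mu>(3)
      by (intro reaches_step) (simp add: machine_step_placed add.assoc eval_nat_numeral)
    ultimately have "reaches code (s, \<nu>) (Suc ?e, \<mu>(r := real y))"
      using \<mu>(1) by (blast intro: reaches_trans)
    moreover have len: "s + length (compile (PrimRec p q) is r b s) = Suc ?e"
      by (simp add: Let_def)
    ultimately show ?thesis
      unfolding computes_into_def len using \<mu>(4)
      by (intro exI[of _ "\<mu>(r := real y)"]) (simp add: agree_below_def)
  qed
next
  case (6 p "is" r b s)
  let ?l = "s + 1"
  let ?cs = "compile p (b # is) (b + 1) (b + 2) ?l"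
  let ?e = "?l + length ?cs + 3"
  from 6(2) have ev: "evaluates p (y # xs) 0" "\<forall>i<y. \<exists>z. evaluates p (i # xs) (Suc z)"
    by (blast elim: evaluates_MinimiseE)+
  have pl: "placed code s [Assign b (Const 0)]" "placed code ?l ?cs"
    "placed code (?l + length ?cs) [Branch (Var (b + 1)) (Const 0) ?e,
       Assign b (Add (Var b) (Const 1)), Jump ?l, Assign r (Var b)]"
    using 6(3) by (simp_all add: Let_def add.assoc)
  \<comment> \<open>One pass through the loop body, with the candidate in \<open>b\<close> and the
    value of \<open>p\<close> there in \<open>b + 1\<close>. The value \<open>z\<close> is kept
    general: it is positive below \<open>y\<close> and zero at \<open>y\<close>.\<close>
  have body: "\<exists>\<mu>'. reaches code (?l, \<mu>) (?l + length ?cs, \<mu>') \<and> \<mu>' b = real i \<and>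
      \<mu>' (b + 1) = real z \<and> agree_below b \<nu> \<mu>'"
    if \<mu>: "\<mu> b = real i" "agree_below b \<nu> \<mu>" and z: "evaluates p (i # xs) z" for i z \<mu>
  proof -
    have "computes_into code ?l (?l + length ?cs) (b + 1) (b + 2) z \<mu>"
    proof (rule 6(1)[OF refl z pl(2)])
      show "map \<mu> (b # is) = map real (i # xs)"
        using \<mu> agree_below_map[OF \<mu>(2) 6(5)] 6(4) by simp
      show "set (b # is) \<subseteq> {..<b + 2}" using 6(5) by auto
    qed simp
    then obtain \<mu>' where "reaches code (?l, \<mu>) (?l + length ?cs, \<mu>')"
      "\<mu>' (b + 1) = real z" "\<And>x. x < b + 2 \<Longrightarrow> x \<noteq> b + 1 \<Longrightarrow> \<mu>' x = \<mu> x"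
      by (rule computes_intoE) blast
    with \<mu> show ?thesis by (intro exI[of _ \<mu>']) (simp add: agree_below_def)
  qed
  have loop: "\<exists>\<mu>. reaches code (s, \<nu>) (?l, \<mu>) \<and> \<mu> b = real i \<and> agree_below b \<nu> \<mu>"
    if "i \<le> y" for i
    using that
  proof (induction i)
    case 0
    have "reaches code (s, \<nu>) (?l, \<nu>(b := 0))"
      using pl(1) by (auto intro!: reaches_step simp: machine_step_placed)
    moreover have "(\<nu>(b := 0)) b = real 0" by simp
    moreover have "agree_below b \<nu> (\<nu>(b := 0))" by (simp add: agree_below_def)
    ultimately show ?case by blast
  next
    case (Suc i)
    then obtain \<mu> where \<mu>: "reaches code (s, \<nu>) (?l, \<mu>)" "\<mu> b = real i" "agree_below b \<nu> \<mu>" by auto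
    \<comment> \<open>Minimisation requires \<open>p\<close> to terminate with a positive value at
      every smaller candidate, so the search neither gets stuck nor stops early.\<close>
    from ev(2) Suc.prems obtain z where "evaluates p (i # xs) (Suc z)"
      by (meson Suc_le_eq)
    from body[OF \<mu>(2,3) this] obtain \<mu>' where \<mu>': "reaches code (?l, \<mu>) (?l + length ?cs, \<mu>')"
      "\<mu>' b = real i" "\<mu>' (b + 1) = real (Suc z)" "agree_below b \<nu> \<mu>'" by blast
    define \<mu>1 where "\<mu>1 = \<mu>'(b := real (Suc i))"
    have "reaches code (?l + length ?cs, \<mu>') (Suc (?l + length ?cs), \<mu>')"
      using pl(3) \<mu>'(3) by (auto intro!: reaches_step simp: machine_step_placed)
    moreover have "reaches code (Suc (?l + length ?cs), \<mu>') (Suc (Suc (?l + length ?cs)), \<mu>1)"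
      using pl(3) \<mu>'(2) by (auto intro!: reaches_step simp: machine_step_placed \<mu>1_def add.commute)
    moreover have "reaches code (Suc (Suc (?l + length ?cs)), \<mu>1) (?l, \<mu>1)"
      using pl(3) by (auto intro!: reaches_step simp: machine_step_placed)
    ultimately have "reaches code (s, \<nu>) (?l, \<mu>1)"
      using \<mu>(1) \<mu>'(1) by (blast intro: reaches_trans)
    moreover have "agree_below b \<nu> \<mu>1" using \<mu>'(4) by (simp add: agree_below_def \<mu>1_def)
    moreover have "\<mu>1 b = real (Suc i)" by (simp add: \<mu>1_def)
    ultimately show ?case by blast
  qed
  obtain \<mu> where \<mu>: "reaches code (s, \<nu>) (?l, \<mu>)" "\<mu> b = real y" "agree_below b \<nu> \<mu>"
    using loop[of y] by auto
  from body[OF \<mu>(2,3) ev(1)] obtain \<mu>' where \<mu>': "reaches code (?l, \<mu>) (?l + length ?cs, \<mu>')"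
    "\<mu>' b = real y" "\<mu>' (b + 1) = 0" "agree_below b \<nu> \<mu>'" by auto
  have "reaches code (?l + length ?cs, \<mu>') (?e, \<mu>')"
    using pl(3) \<mu>'(3) by (auto intro!: reaches_step simp: machine_step_placed)
  moreover have "reaches code (?e, \<mu>') (Suc ?e, \<mu>'(r := real y))"
    using pl(3) \<mu>'(2) by (intro reaches_step) (simp add: machine_step_placed add.assoc eval_nat_numeral)
  ultimately have "reaches code (s, \<nu>) (Suc ?e, \<mu>'(r := real y))"
    using \<mu>(1) \<mu>'(1) by (blast intro: reaches_trans)
  moreover have len: "s + length (compile (Minimise p) is r b s) = Suc ?e"
    by (simp add: Let_def)
  ultimately show ?case
    unfolding computes_into_def len using \<mu>'(4)
    by (intro exI[of _ "\<mu>'(r := real y)"]) (simp add: agree_below_def)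
next
  case (7 "is" r b s)
  then show ?case by (auto simp: agree_below_def intro: reaches_refl)
next
  case (8 q qs "is" r b s)
  let ?cs = "compile q is r b s"
  let ?ds = "compile_list qs is (Suc r) b (s + length ?cs)"
  from 8(3) obtain y ys' where ys: "ys = y # ys'" "evaluates q xs y"
    "list_all2 (\<lambda>q y. evaluates q xs y) qs ys'" by (auto simp: list_all2_Cons1)
  have pl: "placed code s ?cs" "placed code (s + length ?cs) ?ds"
    using 8(4) by (simp_all add: Let_def)
  have "computes_into code s (s + length ?cs) r b y \<nu>"
    by (rule 8(1)[OF ys(2) pl(1) 8(5)]) (use 8(6,7) in auto)
  then obtain \<nu>1 where \<nu>1: "reaches code (s, \<nu>) (s + length ?cs, \<nu>1)"
    "\<nu>1 r = real y" "\<And>x. x < b \<Longrightarrow> x \<noteq> r \<Longrightarrow> \<nu>1 x = \<nu> x" by (rule computes_intoE) blast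
  then have ag: "agree_below r \<nu> \<nu>1" using 8(7) by (auto simp: agree_below_def)
  have "\<exists>\<nu>'. reaches code (s + length ?cs, \<nu>1) (s + length ?cs + length ?ds, \<nu>') \<and>
       map \<nu>' [Suc r..<Suc r + length qs] = map real ys' \<and> agree_below (Suc r) \<nu>1 \<nu>'"
    by (rule 8(2)[OF refl ys(3) pl(2)])
      (use agree_below_map[OF ag 8(6)] 8(5,6,7) in auto)
  then obtain \<nu>2 where \<nu>2: "reaches code (s + length ?cs, \<nu>1) (s + length ?cs + length ?ds, \<nu>2)"
    "map \<nu>2 [Suc r..<Suc r + length qs] = map real ys'" "agree_below (Suc r) \<nu>1 \<nu>2" by blast
  have "[r..<r + length (q # qs)] = r # [Suc r..<Suc r + length qs]"
    by (simp add: upt_conv_Cons del: upt_Suc)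
  then have "map \<nu>2 [r..<r + length (q # qs)] = map real ys"
    using \<nu>2(2,3) \<nu>1(2) ys(1) by (simp add: agree_below_def)
  moreover have "agree_below r \<nu> \<nu>2" using ag \<nu>2(3) by (simp add: agree_below_def)
  ultimately show ?case
    using reaches_trans[OF \<nu>1(1) \<nu>2(1)] by (auto simp: Let_def add.assoc simp del: upt_Suc)
qed

section \<open>Register machines as hybrid automata\<close>

definition truth :: "'v fm" where
  "truth = Eq (Const 0) (Const 0)"

text \<open>A jump predicate leaves unmentioned primed variables arbitrary, so every register gets
  an equation, unchanged ones included.\<close>

definition update_fm :: "nat \<Rightarrow> (nat \<Rightarrow> nat tm) \<Rightarrow> (nat + nat) fm" where
  "update_fm n f = foldr (\<lambda>x. And (Eq (Var (Inr x)) (map_tm Inl (f x)))) [0..<n] truth"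

text \<open>The two guards of a branch are complementary, so exactly one of its edges is
  enabled.\<close>

primrec edges_of :: "nat \<Rightarrow> nat \<Rightarrow> instr \<Rightarrow> edge_presentation list" where
  "edges_of n l (Assign r t) = [(l, truth, 0, update_fm n (Var(r := t)), Suc l)]"
| "edges_of n l (Branch s t k) =
     [(l, Eq s t, 0, update_fm n Var, k), (l, Neg (Eq s t), 0, update_fm n Var, Suc l)]"
| "edges_of n l (Jump k) = [(l, truth, 0, update_fm n Var, k)]"

primrec instr_vars :: "instr \<Rightarrow> nat set" where
  "instr_vars (Assign r t) = insert r (term_vars t)"
| "instr_vars (Branch s t k) = term_vars s \<union> term_vars t"
| "instr_vars (Jump k) = {}"

primrec targets :: "nat \<Rightarrow> instr \<Rightarrow> nat set" where
  "targets l (Assign r t) = {Suc l}"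
| "targets l (Branch s t k) = {k, Suc l}"
| "targets l (Jump k) = {k}"

text \<open>The automaton has finitely many modes and variables, so the machine must stay within
  \<open>M\<close> program counters and \<open>n\<close> registers. \<open>M\<close> may exceed the
  length of the code, as halting positions beyond its end need modes as well.\<close>

definition fits :: "instr list \<Rightarrow> nat \<Rightarrow> nat \<Rightarrow> bool" where
  "fits code n M \<longleftrightarrow>
     (\<forall>l<M. instr_vars (fetch code l) \<subseteq> {..<n} \<and> targets l (fetch code l) \<subseteq> {..<M})"

definition mode_table :: "nat \<Rightarrow> nat \<Rightarrow> nat \<Rightarrow> mode_presentation list" where
  "mode_table n M acc =
     map (\<lambda>l. (truth, replicate n (Const 0), if l = acc then [0] else [])) [0..<M]"

definition edge_table :: "instr list \<Rightarrow> nat \<Rightarrow> nat \<Rightarrow> edge_presentation list" where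
  "edge_table code n M = concat (map (\<lambda>l. edges_of n l (fetch code l)) [0..<M])"

definition machine_presentation ::
  "instr list \<Rightarrow> nat \<Rightarrow> nat \<Rightarrow> nat \<Rightarrow> nat fm \<Rightarrow> presentation" where
  "machine_presentation code n M acc start =
     \<lparr>num_actions = 1, num_vars = n, num_props = 1, start_modes = [0],
      mode_list = mode_table n M acc, edge_list = edge_table code n M, start_pred = start\<rparr>"

definition safety :: "nat ltl" where
  "safety = Box (LNot (Prop 0))"

section \<open>Meaning of the translated instructions\<close>

lemma holds_truth [simp]: "holds e truth"
  by (simp add: truth_def)

lemma pred_vars_truth [simp]: "pred_vars truth = {}"
  by (simp add: truth_def)

lemma term_value_map_tm: "term_value e (map_tm f t) = term_value (e \<circ> f) t"
  by (induction t) auto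

lemma holds_foldr_And:
  "holds e (foldr (\<lambda>x. And (F x)) xs truth) \<longleftrightarrow> (\<forall>x\<in>set xs. holds e (F x))"
  by (induction xs) auto

lemma pred_vars_foldr_And:
  "pred_vars (foldr (\<lambda>x. And (F x)) xs truth) = (\<Union>x\<in>set xs. pred_vars (F x))"
  by (induction xs) auto

lemma holds_update_fm:
  "holds (case_sum \<nu> \<nu>') (update_fm n f) \<longleftrightarrow> (\<forall>x<n. \<nu>' x = term_value \<nu> (f x))"
  unfolding update_fm_def holds_foldr_And
  by (auto simp: term_value_map_tm comp_def)

lemma pred_vars_update_fm:
  assumes "\<And>x. x < n \<Longrightarrow> term_vars (f x) \<subseteq> {..<n}"
  shows "pred_vars (update_fm n f) \<subseteq> {..<n} <+> {..<n}"
  using assms unfolding update_fm_def pred_vars_foldr_And by (fastforce simp: tm.set_map)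

lemma valuations_eqI:
  assumes "\<nu> \<in> valuations X" "\<mu> \<in> valuations X" "\<And>x. x \<in> X \<Longrightarrow> \<nu> x = \<mu> x"
  shows "\<nu> = \<mu>"
  using assms unfolding valuations_def by (rule PiE_ext)

lemma valuations_update:
  "\<nu> \<in> valuations X \<Longrightarrow> r \<in> X \<Longrightarrow> \<nu>(r := v) \<in> valuations X"
  by (auto simp: valuations_def PiE_def extensional_def)

lemma edges_of_exec:
  assumes "instr_vars i \<subseteq> {..<n}" "\<nu> \<in> valuations {..<n}" "\<nu>' \<in> valuations {..<n}"
  shows "(\<exists>g j. (l, g, a, j, l') \<in> set (edges_of n l i) \<and> holds \<nu> g \<and> holds (case_sum \<nu> \<nu>') j) \<longleftrightarrow>
    a = 0 \<and> (l', \<nu>') = exec i (l, \<nu>)"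
proof -
  \<comment> \<open>Valuations are undefined outside \<open>{..<n}\<close>, so agreement on the
    \<open>n\<close> registers is equality.\<close>
  have same: "(\<forall>x<n. \<nu>' x = \<nu> x) \<longleftrightarrow> \<nu>' = \<nu>"
    using valuations_eqI[OF assms(3,2)] by auto
  have upd: "(\<forall>x<n. \<nu>' x = term_value \<nu> (if x = r then t else Var x)) \<longleftrightarrow>
      \<nu>' = \<nu>(r := term_value \<nu> t)" if "r < n" for r t
    using valuations_eqI[OF assms(3) valuations_update[OF assms(2)], of r "term_value \<nu> t"] that
    by (auto split: if_splits)
  show ?thesis
    using assms(1) by (cases i) (auto simp: holds_update_fm fun_upd_def[of Var] upd same
        ex_disj_distrib conj_disj_distribR)
qed

lemma edges_of_source: "(m, g, a, j, m') \<in> set (edges_of n l i) \<Longrightarrow> m = l"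
  by (cases i) auto

lemma edges_of_wf:
  assumes "(m, g, a, j, m') \<in> set (edges_of n l i)" "instr_vars i \<subseteq> {..<n}"
  shows "pred_vars g \<subseteq> {..<n}" "pred_vars j \<subseteq> {..<n} <+> {..<n}" "a = 0" "m' \<in> targets l i"
proof -
  have "pred_vars (update_fm n Var) \<subseteq> {..<n} <+> {..<n}"
    by (rule pred_vars_update_fm) auto
  moreover have "pred_vars (update_fm n (Var(r := t))) \<subseteq> {..<n} <+> {..<n}"
    if "term_vars t \<subseteq> {..<n}" for r t
    by (rule pred_vars_update_fm) (use that in auto)
  ultimately show "pred_vars g \<subseteq> {..<n}" "pred_vars j \<subseteq> {..<n} <+> {..<n}"
    "a = 0" "m' \<in> targets l i"
    using assms by (cases i; force)+
qed

lemma edge_table_iff: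
  "(m, g, a, j, m') \<in> set (edge_table code n M) \<longleftrightarrow>
     m < M \<and> (m, g, a, j, m') \<in> set (edges_of n m (fetch code m))"
  by (auto simp: edge_table_def dest: edges_of_source)

section \<open>Runs and traces under flow 0\<close>

lemma advance_zero:
  assumes "\<And>\<mu> x. \<mu> \<in> valuations X \<Longrightarrow> x \<in> X \<Longrightarrow> f \<mu> x = 0"
    and \<nu>: "\<nu> \<in> valuations X" and t: "t \<ge> 0"
  shows "advance X f \<nu> t = \<nu>"
  unfolding advance_def
proof (rule the_equality)
  have "ode_solution X f \<nu> (\<lambda>_. \<nu>)"
    using assms by (auto simp: ode_solution_def)
  then show "\<exists>u. ode_solution X f \<nu> u \<and> u t = \<nu>" by blast
next
  fix \<mu> assume "\<exists>u. ode_solution X f \<nu> u \<and> u t = \<mu>"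
  then obtain u where u: "ode_solution X f \<nu> u" "u t = \<mu>" by blast
  show "\<mu> = \<nu>"
  proof (rule valuations_eqI[OF _ \<nu>])
    show "\<mu> \<in> valuations X" using u t by (auto simp: ode_solution_def)
  next
    fix x assume x: "x \<in> X"
    \<comment> \<open>Every solution has derivative 0 on the convex half-line \<open>{0..}\<close>
      and is therefore constant, which gives the uniqueness behind \<open>THE\<close>.\<close>
    have "((\<lambda>s. u s x) has_field_derivative 0) (at s within {0..})" if "s \<in> {0..}" for s
    proof -
      have "u s \<in> valuations X" "((\<lambda>s. u s x) has_field_derivative f (u s) x) (at s within {0..})"
        using u(1) that x by (auto simp: ode_solution_def)
      with assms(1) x show ?thesis by simp
    qed
    then obtain c where "\<And>s. s \<in> {0..} \<Longrightarrow> u s x = c"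
      using has_field_derivative_zero_constant[of "{0..}" "\<lambda>s. u s x"] by auto
    from this[of t] this[of 0] show "\<mu> x = \<nu> x" using u t by (auto simp: ode_solution_def)
  qed
qed

lemma field_of_zero: "x < n \<Longrightarrow> field_of n (replicate n (Const 0)) \<nu> x = 0"
  by (simp add: field_of_def)

lemma mode_table_nth [simp]:
  "l < M \<Longrightarrow> mode_table n M acc ! l =
     (truth, replicate n (Const 0), if l = acc then [0] else [])"
  by (simp add: mode_table_def)

lemma length_mode_table [simp]: "length (mode_table n M acc) = M"
  by (simp add: mode_table_def)

lemma machine_automaton_simps:
  fixes code n M acc start
  defines "H \<equiv> automaton_of (machine_presentation code n M acc start)"
  shows "variables H = {..<n}" "modes H = {..<M}" "initial_modes H = {0}" "actions H = {..<1}"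
    "initial_valuations H = pred_of n start"
    "transitions H =
       (\<lambda>(m, g, a, j, m'). (m, pred_of n g, a, jump_of n j, m')) ` set (edge_table code n M)"
    "l < M \<Longrightarrow> invariant H l = valuations {..<n}"
    "l < M \<Longrightarrow> flow H l = field_of n (replicate n (Const 0))"
  by (simp_all add: H_def automaton_of_def machine_presentation_def Let_def pred_of_def)

lemma configurations_machine:
  "configurations (automaton_of (machine_presentation code n M acc start)) =
     {..<M} \<times> valuations {..<n}"
  by (auto simp: configurations_def machine_automaton_simps)

text \<open>The conditions on edges come from \<open>fits\<close>, the initial mode 0 exists by
  \<open>0 < M\<close>, and the zero field is Lipschitz with constant 0.\<close>

lemma wf_machine_presentation:
  assumes "fits code n M" "0 < M" "pred_vars start \<subseteq> {..<n}"
  shows "wf_presentation (machine_presentation code n M acc start)" (is "wf_presentation ?d")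
proof -
  let ?H = "automaton_of ?d"
  have edge: "pred_vars g \<subseteq> {..<n} \<and> pred_vars j \<subseteq> {..<n} <+> {..<n} \<and> m < M \<and> a = 0 \<and> m' < M"
    if "(m, g, a, j, m') \<in> set (edge_table code n M)" for m g a j m'
    using that assms(1) edges_of_wf[of m g a j m' n m "fetch code m"]
    unfolding edge_table_iff fits_def by blast
  have "transitions ?H \<subseteq> modes ?H \<times> Pow (valuations (variables ?H)) \<times> actions ?H
       \<times> Pow (valuations (variables ?H) \<times> valuations (variables ?H)) \<times> modes ?H"
    unfolding machine_automaton_simps by (auto simp: pred_of_def jump_of_def dest!: edge)
  moreover have "flow ?H m \<in> valuations (variables ?H) \<rightarrow> valuations (variables ?H) \<and>
      lipschitz_field (variables ?H) (flow ?H m)" if "m \<in> modes ?H" for m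
  proof -
    have m: "m < M" using that by (simp add: machine_automaton_simps)
    have "lipschitz_field {..<n} (field_of n (replicate n (Const 0)))"
      unfolding lipschitz_field_def euclidean_dist_def
      by (intro exI[of _ 0]) (simp add: field_of_zero L2_set_def)
    moreover have "field_of n (replicate n (Const 0)) \<nu> \<in> valuations {..<n}" for \<nu>
      by (simp add: field_of_def valuations_def)
    ultimately show ?thesis by (simp add: machine_automaton_simps m)
  qed
  moreover have "initial_valuations ?H \<subseteq> valuations (variables ?H)"
    by (auto simp: machine_automaton_simps pred_of_def)
  ultimately have "wf_hybrid_automaton ?H"
    using assms(2) by (simp add: wf_hybrid_automaton_def machine_automaton_simps)
  then have "wf_hybrid_kripke (kripke_of ?d)"
    by (auto simp: wf_hybrid_kripke_def kripke_of_def machine_automaton_simps(2))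
      (auto simp: machine_presentation_def split: if_splits)
  then show ?thesis
    using edge assms(3)
    by (auto simp: wf_presentation_def machine_presentation_def mode_table_def dest!: edge)
qed

text \<open>Time passes without effect under flow 0, so any delay is possible and the successor is
  that of the deterministic machine.\<close>

lemma step_machine:
  assumes "fits code n M" "l < M" "\<nu> \<in> valuations {..<n}"
  shows "step (automaton_of (machine_presentation code n M acc start)) (l, \<nu>) (t, a) c' \<longleftrightarrow>
    t \<ge> 0 \<and> a = 0 \<and> c' = machine_step code (l, \<nu>)"
proof -
  let ?H = "automaton_of (machine_presentation code n M acc start)"
  let ?i = "fetch code l"
  obtain l' \<nu>' where c': "c' = (l', \<nu>')" by (cases c')
  have i: "instr_vars ?i \<subseteq> {..<n}" "targets l ?i \<subseteq> {..<M}"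
    using assms(1,2) by (auto simp: fits_def)
  have conf: "c' \<in> configurations ?H" if "c' = machine_step code (l, \<nu>)"
    using that i assms(3) unfolding configurations_machine
    by (cases ?i) (auto simp: machine_step_def valuations_update)
  have adv: "advance {..<n} (field_of n (replicate n (Const 0))) \<nu> s = \<nu>" if "s \<ge> 0" for s
    by (rule advance_zero) (use assms(3) that in \<open>auto simp: field_of_zero\<close>)
  \<comment> \<open>Transitions contain sets rather than formulas; unfolding the image recovers the
    formulas, to which \<open>edges_of_exec\<close> applies.\<close>
  have trans: "(\<exists>g j. (l, g, a, j, l') \<in> transitions ?H \<and> \<nu> \<in> g \<and> (\<nu>, \<nu>') \<in> j) \<longleftrightarrow>
      a = 0 \<and> c' = machine_step code (l, \<nu>)" if "\<nu>' \<in> valuations {..<n}"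
  proof -
    have "(\<exists>g j. (l, g, a, j, l') \<in> transitions ?H \<and> \<nu> \<in> g \<and> (\<nu>, \<nu>') \<in> j) \<longleftrightarrow>
        (\<exists>g j. (l, g, a, j, l') \<in> set (edges_of n l ?i) \<and> \<nu> \<in> pred_of n g \<and> (\<nu>, \<nu>') \<in> jump_of n j)"
      unfolding machine_automaton_simps image_iff Bex_def split_paired_Ex edge_table_iff
      using assms(2) by (auto; blast)
    also have "\<dots> \<longleftrightarrow> (\<exists>g j. (l, g, a, j, l') \<in> set (edges_of n l ?i) \<and> holds \<nu> g \<and>
        holds (case_sum \<nu> \<nu>') j)"
      using assms(3) that by (simp add: pred_of_def jump_of_def)
    also have "\<dots> \<longleftrightarrow> a = 0 \<and> c' = machine_step code (l, \<nu>)"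
      unfolding edges_of_exec[OF i(1) assms(3) that] by (simp add: c' machine_step_def)
    finally show ?thesis .
  qed
  have "step ?H (l, \<nu>) (t, a) c' \<longleftrightarrow> c' \<in> configurations ?H \<and> t \<ge> 0 \<and>
      (\<exists>g j. (l, g, a, j, l') \<in> transitions ?H \<and> \<nu> \<in> g \<and> (\<nu>, \<nu>') \<in> j)"
    using assms(2,3) unfolding c' step_def
    by (auto simp: machine_automaton_simps(1,7,8) configurations_machine adv; blast)
  also have "\<dots> \<longleftrightarrow> t \<ge> 0 \<and> a = 0 \<and> c' = machine_step code (l, \<nu>)"
    using trans conf by (auto simp: c' configurations_machine)
  finally show ?thesis .
qed

lemma machine_step_configuration:
  assumes "fits code n M" "c \<in> {..<M} \<times> valuations {..<n}"
  shows "(machine_step code ^^ i) c \<in> {..<M} \<times> valuations {..<n}"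
proof (induction i)
  case 0
  then show ?case using assms(2) by simp
next
  case (Suc i)
  obtain l \<nu> where c: "(machine_step code ^^ i) c = (l, \<nu>)" by force
  with Suc have "l < M" "\<nu> \<in> valuations {..<n}" by auto
  then have "instr_vars (fetch code l) \<subseteq> {..<n}" "targets l (fetch code l) \<subseteq> {..<M}"
    using assms(1) by (auto simp: fits_def)
  then have "machine_step code (l, \<nu>) \<in> {..<M} \<times> valuations {..<n}"
    using \<open>\<nu> \<in> valuations {..<n}\<close>
    by (cases "fetch code l") (auto simp: machine_step_def valuations_update)
  with c show ?case by simp
qed

text \<open>Labels are quantified away because delays are arbitrary; apart from them a run is
  determined by its initial valuation.\<close>

lemma infinite_run_machine:
  assumes "fits code n M" "0 < M"
  shows "(\<exists>l. infinite_run (automaton_of (machine_presentation code n M acc start)) c l) \<longleftrightarrow>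
    (\<exists>\<nu>\<in>pred_of n start. c = (\<lambda>i. (machine_step code ^^ i) (0, \<nu>)))"
    (is "(\<exists>l. infinite_run ?H c l) \<longleftrightarrow> ?R")
proof -
  have init: "initial_configurations ?H = {0} \<times> pred_of n start"
    using assms(2)
    by (auto simp: initial_configurations_def configurations_machine machine_automaton_simps
        pred_of_def)
  show ?thesis
  proof
    assume "\<exists>l. infinite_run ?H c l"
    then obtain l where l: "c 0 \<in> initial_configurations ?H" "\<And>i. step ?H (c i) (l i) (c (Suc i))"
      by (auto simp: infinite_run_def)
    then obtain \<nu> where \<nu>: "\<nu> \<in> pred_of n start" "c 0 = (0, \<nu>)" by (auto simp: init)
    have "c i = (machine_step code ^^ i) (0, \<nu>)" for i
    proof (induction i)
      case (Suc i)
      have "c i \<in> {..<M} \<times> valuations {..<n}"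
        unfolding Suc using \<nu>(1) assms
        by (intro machine_step_configuration) (auto simp: pred_of_def)
      then have "c (Suc i) = machine_step code (c i)"
        using l(2)[of i] step_machine[OF assms(1)] by (cases "c i"; cases "l i") auto
      with Suc show ?case by simp
    qed (use \<nu> in simp)
    with \<nu>(1) show ?R by blast
  next
    assume ?R
    then obtain \<nu> where \<nu>: "\<nu> \<in> pred_of n start" "c = (\<lambda>i. (machine_step code ^^ i) (0, \<nu>))"
      by blast
    have "step ?H (c i) (0, 0) (c (Suc i))" for i
    proof -
      have "c i \<in> {..<M} \<times> valuations {..<n}"
        unfolding \<nu>(2) using \<nu>(1) assms
        by (intro machine_step_configuration) (auto simp: pred_of_def)
      moreover have "c (Suc i) = machine_step code (c i)" by (simp add: \<nu>(2))
      ultimately show ?thesis using step_machine[OF assms(1)] by (cases "c i") auto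
    qed
    moreover have "c 0 \<in> initial_configurations ?H" using \<nu> by (simp add: init)
    ultimately have "infinite_run ?H c (\<lambda>_. (0, 0))" by (simp add: infinite_run_def)
    then show "\<exists>l. infinite_run ?H c l" by blast
  qed
qed

text \<open>Among the modes only \<open>acc\<close> carries proposition 0, so \<open>safety\<close>
  expresses that \<open>acc\<close> is never visited.\<close>

lemma kripke_models_machine:
  assumes "fits code n M" "0 < M"
  shows "kripke_models (kripke_of (machine_presentation code n M acc start)) safety \<longleftrightarrow>
    (\<forall>\<nu>\<in>pred_of n start. \<forall>\<nu>'. \<not> reaches code (0, \<nu>) (acc, \<nu>'))" (is "?L \<longleftrightarrow> ?R")
proof -
  let ?c = "\<lambda>\<nu> i. (machine_step code ^^ i) (0, \<nu>)"
  let ?label = "\<lambda>m. set (snd (snd (mode_table n M acc ! m)))"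
  have "traces (kripke_of (machine_presentation code n M acc start)) =
      {\<lambda>i. ?label (fst (c i)) | c.
        \<exists>l. infinite_run (automaton_of (machine_presentation code n M acc start)) c l}"
    by (auto simp: traces_def kripke_of_def machine_presentation_def)
  also have "\<dots> = (\<lambda>\<nu> i. ?label (fst (?c \<nu> i))) ` pred_of n start"
    unfolding infinite_run_machine[OF assms] by auto
  finally have "?L \<longleftrightarrow> (\<forall>\<nu>\<in>pred_of n start. \<forall>i. 0 \<notin> ?label (fst (?c \<nu> i)))"
    by (simp add: kripke_models_def safety_def suffix_from_def)
  also have "\<dots> \<longleftrightarrow> (\<forall>\<nu>\<in>pred_of n start. \<forall>i. fst (?c \<nu> i) \<noteq> acc)"
  proof (intro ball_cong refl all_cong1)
    \<comment> \<open>The iterates stay among the first \<open>M\<close> modes, where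
      \<open>mode_table_nth\<close> determines the label; a list access beyond the end has no known
      value.\<close>
    fix \<nu> i assume "\<nu> \<in> pred_of n start"
    then have "?c \<nu> i \<in> {..<M} \<times> valuations {..<n}"
      using assms by (intro machine_step_configuration) (auto simp: pred_of_def)
    then show "0 \<notin> ?label (fst (?c \<nu> i)) \<longleftrightarrow> fst (?c \<nu> i) \<noteq> acc" by auto
  qed
  also have "\<dots> \<longleftrightarrow> ?R"
    unfolding reaches_def by (metis fst_conv prod.collapse)
  finally show ?thesis .
qed

lemma fits_exists:
  obtains n M where "fits code n M" "n0 \<le> n" "0 < M"
proof -
  have fin: "finite (term_vars t)" for t :: "nat tm" by (induction t) auto
  have "finite (instr_vars i)" for i by (cases i) (auto intro: fin)
  then have "finite (\<Union>i\<in>set code. instr_vars i)" by blast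
  then obtain n where n: "(\<Union>i\<in>set code. instr_vars i) \<subseteq> {..<n}"
    by (meson finite_nat_iff_bounded)
  have "finite (targets l i)" for l i by (cases i) auto
  then have "finite (\<Union>l<length code. targets l (code ! l))" by blast
  then obtain M where M: "(\<Union>l<length code. targets l (code ! l)) \<subseteq> {..<M}"
    by (meson finite_nat_iff_bounded)
  \<comment> \<open>Taking \<open>Suc (length code)\<close> into the maximum makes the number of
    modes positive. Modes from the end of the code on loop to themselves, so adding them keeps the
    bound closed under jumps.\<close>
  have "fits code (max n n0) (max M (Suc (length code)))"
    unfolding fits_def fetch_def
  proof (intro allI impI conjI)
    fix l
    have "instr_vars (code ! l) \<subseteq> {..<n}" if "l < length code"
      using n that by (meson UN_subset_iff nth_mem)
    then show "instr_vars (if l < length code then code ! l else Jump l) \<subseteq> {..<max n n0}"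
      by (auto simp: less_max_iff_disj)
  next
    fix l assume l: "l < max M (Suc (length code))"
    have "targets l (code ! l) \<subseteq> {..<M}" if "l < length code"
      using M that by blast
    with l show "targets l (if l < length code then code ! l else Jump l) \<subseteq>
        {..<max M (Suc (length code))}"
      by (cases "l < length code") (auto simp: less_max_iff_disj)
  qed
  with that[of "max n n0" "max M (Suc (length code))"] show thesis by simp
qed

section \<open>Computing the code of the automaton\<close>

text \<open>Closure rules for this notion spare an explicit program for the encoding.\<close>

definition computable :: "nat \<Rightarrow> (nat list \<Rightarrow> nat) \<Rightarrow> bool" where
  "computable k f \<longleftrightarrow> (\<exists>p. \<forall>xs. length xs = k \<longrightarrow> evaluates p xs (f xs))"

lemma computableI: "(\<And>xs. length xs = k \<Longrightarrow> evaluates p xs (f xs)) \<Longrightarrow> computable k f"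
  by (auto simp: computable_def)

lemma computable_nth: "i < k \<Longrightarrow> computable k (\<lambda>xs. xs ! i)"
  by (rule computableI[of _ "Proj i"]) (auto intro: proj)

lemma computable_comp1:
  assumes "\<And>x. evaluates p [x] (g x)" "computable k f"
  shows "computable k (\<lambda>xs. g (f xs))"
proof -
  from assms(2) obtain q where "\<And>xs. length xs = k \<Longrightarrow> evaluates q xs (f xs)"
    by (auto simp: computable_def)
  with assms(1) show ?thesis
    by (intro computableI[of _ "Comp p [q]"] comp[where ys = "[f xs]" for xs]) auto
qed

lemma computable_comp2:
  assumes "\<And>x y. evaluates p [x, y] (g x y)" "computable k f" "computable k h"
  shows "computable k (\<lambda>xs. g (f xs) (h xs))"
proof -
  from assms(2,3) obtain q r where "\<And>xs. length xs = k \<Longrightarrow> evaluates q xs (f xs)"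
    "\<And>xs. length xs = k \<Longrightarrow> evaluates r xs (h xs)"
    by (auto simp: computable_def)
  with assms(1) show ?thesis
    by (intro computableI[of _ "Comp p [q, r]"] comp[where ys = "[f xs, h xs]" for xs]) auto
qed

lemma computable_Suc: "computable k f \<Longrightarrow> computable k (\<lambda>xs. Suc (f xs))"
  by (rule computable_comp1[where p = Succ]) (rule succ)

lemma computable_const: "computable k (\<lambda>xs. c)"
proof (induction c)
  case 0
  show ?case by (rule computableI) (rule zero)
next
  case (Suc c)
  then show ?case by (rule computable_Suc)
qed

lemma computable_add:
  assumes "computable k f" "computable k g" shows "computable k (\<lambda>xs. f xs + g xs)"
proof -
  have "evaluates (PrimRec (Proj 0) (Comp Succ [Proj 1])) [m, n] (m + n)" for m n
  proof (induction m)
    case 0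
    show ?case using proj[of 0 "[n]"] by (auto intro: rec_0)
  next
    case (Suc m)
    have "evaluates (Comp Succ [Proj 1]) [m, m + n, n] (Suc (m + n))"
      using proj[of 1 "[m, m + n, n]"] by (auto intro!: comp[where ys = "[m + n]"] succ)
    from rec_Suc[OF Suc this] show ?case by simp
  qed
  from computable_comp2[OF this assms] show ?thesis .
qed

text \<open>\<open>triangle (Suc n) = triangle n + Suc n\<close> is a primitive recursion. With
  addition it yields pairing, as \<open>prod_encode (m, n) = triangle (m + n) + m\<close>.\<close>

lemma computable_triangle:
  assumes "computable k f" shows "computable k (\<lambda>xs. triangle (f xs))"
proof -
  have "computable 2 (\<lambda>xs. Suc (xs ! 0) + xs ! 1)"
    by (intro computable_add computable_Suc computable_nth) auto
  then obtain p where p: "\<And>xs. length xs = 2 \<Longrightarrow> evaluates p xs (Suc (xs ! 0) + xs ! 1)"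
    by (auto simp: computable_def)
  have "evaluates (PrimRec Zero p) [n] (triangle n)" for n
  proof (induction n)
    case 0
    show ?case by (auto intro: rec_0 zero)
  next
    case (Suc n)
    from rec_Suc[OF Suc p] show ?case by (simp add: add.commute)
  qed
  from computable_comp1[OF this assms] show ?thesis .
qed

lemma computable_prod_encode:
  assumes "computable k f" "computable k g" shows "computable k (\<lambda>xs. prod_encode (f xs, g xs))"
  unfolding prod_encode_def by (simp add: assms computable_add computable_triangle)

lemmas computable_intros = computable_nth computable_const computable_Suc computable_add
  computable_prod_encode

text \<open>The numbers enter only as constants, which makes the code of the formula computable from
  them. Further registers stay free, since \<open>compile_correct\<close> assumes nothing about
  scratch space.\<close>

definition start_fm :: "nat \<Rightarrow> nat \<Rightarrow> nat \<Rightarrow> nat fm" where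
  "start_fm x y z = And (Eq (Var 0) (Const (of_nat x)))
     (And (Eq (Var 1) (Const (of_nat y))) (Eq (Var 2) (Const (of_nat z))))"

text \<open>The numerator is coded by \<open>2 * n\<close>, written as a sum to suit
  \<open>computable_add\<close>, and the denominator 1 by 2.\<close>

lemma encode_rat_of_nat: "encode_rat (of_nat n) = prod_encode (n + n, 2)"
  using quotient_of_int[of "int n"]
  by (simp add: encode_rat_def int_encode_def sum_encode_def)

text \<open>This is the source of self-reference: \<open>s\<close> is chosen before
  \<open>code\<close>, \<open>n\<close>, \<open>M\<close> and \<open>acc\<close>, whose contribution
  it receives only through \<open>x\<close>, \<open>y\<close> and \<open>z\<close>. All other parts
  of the code of the instance are constants or come from \<open>start_fm x y z\<close>.\<close>

lemma computable_encode_instance: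
  "\<exists>s. \<forall>code n M acc x y z. x = n \<longrightarrow> y = list_encode (map encode_mode (mode_table n M acc)) \<longrightarrow>
     z = list_encode (map encode_edge (edge_table code n M)) \<longrightarrow>
     evaluates s [x, y, z]
       (encode_instance (machine_presentation code n M acc (start_fm x y z), safety))"
proof -
  define F where "F xs = prod_encode (list_encode
      [1, xs ! 0, 1, list_encode [0], xs ! 1, xs ! 2,
       encode_fm id (start_fm (xs ! 0) (xs ! 1) (xs ! 2))], encode_ltl safety)" for xs
  \<comment> \<open>The encoded lists have fixed length, so \<open>list_encode\<close> unfolds into
    finitely many pairings and successors.\<close>
  have "computable 3 F"
    unfolding F_def start_fm_def encode_fm.simps encode_tm.simps encode_rat_of_nat
      list_encode.simps
    by (intro computable_intros) auto
  then obtain s where "\<And>xs. length xs = 3 \<Longrightarrow> evaluates s xs (F xs)"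
    by (auto simp: computable_def)
  then have "evaluates s [x, y, z] (F [x, y, z])" for x y z by simp
  then show ?thesis
    by (intro exI[of _ s]) (auto simp: F_def encode_instance_def encode_presentation_def
        machine_presentation_def simp del: encode_fm.simps list_encode.simps)
qed

section \<open>The diagonal argument\<close>

theorem theorem3:
  shows "\<not> decidable encode_instance model_checking_instances
           (\<lambda>(d, \<phi>). kripke_models (kripke_of d) \<phi>)"
proof
  assume "decidable encode_instance model_checking_instances
           (\<lambda>(d, \<phi>). kripke_models (kripke_of d) \<phi>)"
  then obtain p where p: "\<And>d \<phi>. (d, \<phi>) \<in> model_checking_instances \<Longrightarrow>
      evaluates p [encode_instance (d, \<phi>)] (if kripke_models (kripke_of d) \<phi> then 1 else 0)"
    unfolding decidable_def by fast
  obtain s where s: "\<And>code n M acc x y z. x = n \<Longrightarrow>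
      y = list_encode (map encode_mode (mode_table n M acc)) \<Longrightarrow>
      z = list_encode (map encode_edge (edge_table code n M)) \<Longrightarrow>
      evaluates s [x, y, z]
        (encode_instance (machine_presentation code n M acc (start_fm x y z), safety))"
    using computable_encode_instance by metis
  \<comment> \<open>Registers 0 to 2 hold the inputs, 3 receives the answer, and scratch space
    starts at 4.\<close>
  define main where "main = compile (Comp p [s]) [0, 1, 2] 3 4 0"
  define L where "L = length main"
  \<comment> \<open>The branch sits at position \<open>L\<close>: answer 1 leads to
    \<open>L + 2\<close>, any other answer falls through to \<open>L + 1\<close>. Both lie beyond
    the end of the code and are thus distinct halting positions.\<close>
  define code where "code = main @ [Branch (Var 3) (Const 1) (L + 2)]"
  define acc where "acc = L + 2"
  obtain n M where fits: "fits code n M" and n: "3 \<le> n" and M: "0 < M"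
    by (rule fits_exists)
  \<comment> \<open>There is no circularity: \<open>code\<close> is already fixed, and the two
    tables do not mention the initial predicate, which can therefore contain their codes.\<close>
  define y where "y = list_encode (map encode_mode (mode_table n M acc))"
  define z where "z = list_encode (map encode_edge (edge_table code n M))"
  define start where "start = start_fm n y z"
  define d where "d = machine_presentation code n M acc start"
  define answer where "answer = (if kripke_models (kripke_of d) safety then 1 else 0 :: nat)"
  have "pred_vars start \<subseteq> {..<n}" using n by (auto simp: start_def start_fm_def)
  then have "(d, safety) \<in> model_checking_instances"
    using wf_machine_presentation[OF fits M]
    by (simp add: model_checking_instances_def d_def safety_def machine_presentation_def)
  then have "evaluates p [encode_instance (d, safety)] answer"
    unfolding answer_def by (rule p)
  moreover have "evaluates s [n, y, z] (encode_instance (d, safety))"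
    unfolding d_def start_def by (rule s) (simp_all add: y_def z_def)
  ultimately have ev: "evaluates (Comp p [s]) [n, y, z] answer"
    by (intro comp[where ys = "[encode_instance (d, safety)]"]) simp_all
  have halt: "machine_step code (L + k, \<nu>) = (L + k, \<nu>)" if "k > 0" for k \<nu>
    using that by (simp add: machine_step_def fetch_def code_def L_def)
  have run: "\<exists>\<nu>'. reaches code (0, \<nu>) (if answer = 1 then acc else L + 1, \<nu>')"
    if \<nu>: "\<nu> \<in> pred_of n start" for \<nu>
  proof -
    have "map \<nu> [0, 1, 2] = map real [n, y, z]"
      using \<nu> by (simp add: start_def start_fm_def pred_of_def)
    moreover have "placed code 0 main"
      by (simp add: placed_def code_def nth_append)
    ultimately have "computes_into code 0 L 3 4 answer \<nu>"
      using compile_correct(1)[OF ev, of code 0 "[0, 1, 2]" 3 4 \<nu>] by (simp add: main_def L_def)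
    then obtain \<nu>' where \<nu>': "reaches code (0, \<nu>) (L, \<nu>')" "\<nu>' 3 = real answer"
      by (rule computes_intoE)
    have "machine_step code (L, \<nu>') = (if answer = 1 then acc else L + 1, \<nu>')"
      using \<nu>'(2) by (simp add: machine_step_def fetch_def code_def L_def nth_append acc_def)
    from reaches_trans[OF \<nu>'(1) reaches_step[OF this]] show ?thesis by blast
  qed
  have models: "kripke_models (kripke_of d) safety \<longleftrightarrow>
      (\<forall>\<nu>\<in>pred_of n start. \<forall>\<nu>'. \<not> reaches code (0, \<nu>) (acc, \<nu>'))"
    unfolding d_def by (rule kripke_models_machine[OF fits M])
  show False
  proof (cases "kripke_models (kripke_of d) safety")
    case True
    \<comment> \<open>Without initial valuations safety would hold vacuously, so one is exhibited;
      as the answer is 1, its run reaches \<open>acc\<close>. The value \<open>real z\<close> in the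
      registers from 3 on is an arbitrary choice.\<close>
    define \<nu> where "\<nu> = (\<lambda>i\<in>{..<n}. if i = 0 then real n else if i = 1 then real y else real z)"
    have "\<nu> \<in> pred_of n start"
      using n by (auto simp: \<nu>_def pred_of_def start_def start_fm_def valuations_def)
    with run[OF this] True models show False by (auto simp: answer_def)
  next
    case False
    then obtain \<nu> \<nu>1 where \<nu>: "\<nu> \<in> pred_of n start" "reaches code (0, \<nu>) (acc, \<nu>1)"
      using models by blast
    \<comment> \<open>The answer is 0, so the same initial configuration also leads to
      \<open>L + 1\<close>; a deterministic machine cannot come to rest in two places.\<close>
    from run[OF \<nu>(1)] False obtain \<nu>2 where "reaches code (0, \<nu>) (L + 1, \<nu>2)"
      by (auto simp: answer_def)
    from reaches_fixed_unique[OF \<nu>(2) _ this] halt[of 2] halt[of 1] show False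
      by (simp add: acc_def)
  qed
qed

end
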